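(* Let $p$ be an odd prime, $r,q\ge 1$ integers, and $\varepsilon=p^r$. Up to the identification by global scalars, every projective monomial automorphism $(\pi,\sigma,\alpha,\omega)$ of $H=H_{p;r,q}$ is of the form $$\sigma(b)=\frac{s+\lambda b}{1+\varepsilon cb},\qquad \pi(a)=\frac{c+\lambda a}{1+\varepsilon sa},\qquad \omega(b)=H_c(b),\qquad \alpha_a=H_a(s)\qquad(a,b\in R_q)$$ for a unique triple $(c,s,\lambda)\in R_q\times R_q\times R_q^\times$, and every such triple defines a projective monomial automorphism by these formulas. Hence the group $\mathfrak M_{p;r,q}$ of projective monomial automorphisms of $H$ is in bijection with $\{(c,s,\lambda): c,s\in R_q,\ \lambda\in R_q^\times\}$, and $$|\mathfrak M_{p;r,q}|=p^{2q}\varphi(p^q).$$ Under this bijection the composition law is $$(c,s,\lambda)\cdot(c',s',\lambda')=\left(\frac{c+\lambda c'}{u},\ \frac{\lambda' s+s'}{u},\ \frac{\lambda\lambda'+\varepsilon cs'}{u}\right),\qquad u=1+\varepsilon sc'.$$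
   Context: $\mathbf Z_p$ is the ring of $p$-adic integers, $R_q=\mathbf Z/p^q\mathbf Z$, $\varphi$ is Euler's totient function. Fix a faithful (injective) character $\chi$ of the cyclic group $(1+p^r\mathbf Z_p)/(1+p^{q+r}\mathbf Z_p)$ of order $p^q$, with values in complex roots of unity. The matrix $H=H_{p;r,q}$ is indexed by $R_q\times R_q$ with entries $H(a,b)=\chi(1+p^r ab)$ (independent of the lifts of $a,b$ to $\mathbf Z_p$); its rows are written $H_a(b)=\chi(1+\varepsilon ab)$. A projective monomial automorphism of $H$ is a quadruple $(\pi,\sigma,\alpha,\omega)$ consisting of permutations $\pi,\sigma$ of $R_q$ and functions $\alpha,\omega$ on $R_q$ with values in complex numbers of modulus $1$ such that $H_a(\sigma(b))\,\omega(b)=\alpha_a H_{\pi(a)}(b)$ for all $a,b\in R_q$. Two quadruples are identified if they differ by a global scalar, i.e. $(\pi,\sigma,\alpha,\omega)\sim(\pi,\sigma,\zeta\alpha,\zeta\omega)$ with $|\zeta|=1$. The quadruple corresponds to the operator $(Tf)(b)=\omega(b)f(\sigma(b))$ on functions $f:R_q\to\mathbf C$, with $TH_a=\alpha_aH_{\pi(a)}$; the group law on $\mathfrak M_{p;r,q}$ is composition $T\circ T'$ of these operators, so the product of two elements has row permutation $\pi\circ\pi'$ and column permutation $\sigma'\circ\sigma$. Fractions are taken in $R_q$; denominators of the form $1+\varepsilon x$ are units. *)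

theory Defs
  imports "HOL-Number_Theory.Number_Theory" "HOL-Algebra.Coset" "HOL-Algebra.Bij"
begin

text \<open>The $p$-adic integers as the inverse limit of the rings $\mathbf Z/p^n\mathbf Z$: an element
  is the sequence of its least non-negative residues.  At $n = 0$ all residues are $0$, so the unit
  is reduced as well.\<close>

definition padic_ints :: "nat \<Rightarrow> (nat \<Rightarrow> int) ring" where
  "padic_ints p =
     \<lparr>carrier = {x. \<forall>n. x n \<in> {0..<int p ^ n} \<and> x (Suc n) mod int p ^ n = x n},
      monoid.mult = (\<lambda>x y n. (x n * y n) mod int p ^ n),
      one = (\<lambda>n. 1 mod int p ^ n),
      ring.zero = (\<lambda>n. 0),
      add = (\<lambda>x y n. (x n + y n) mod int p ^ n)\<rparr>"

definition padic_of_int :: "nat \<Rightarrow> int \<Rightarrow> (nat \<Rightarrow> int)" where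
  "padic_of_int p m = (\<lambda>n. m mod int p ^ n)"

definition principal_units :: "nat \<Rightarrow> nat \<Rightarrow> (nat \<Rightarrow> int) set" where
  "principal_units p k =
     (\<lambda>x. \<one>\<^bsub>padic_ints p\<^esub> \<oplus>\<^bsub>padic_ints p\<^esub> (padic_of_int p (int p ^ k) \<otimes>\<^bsub>padic_ints p\<^esub> x))
       ` carrier (padic_ints p)"

definition principal_unit_group :: "nat \<Rightarrow> nat \<Rightarrow> (nat \<Rightarrow> int) monoid" where
  "principal_unit_group p k = (units_of (padic_ints p))\<lparr>carrier := principal_units p k\<rparr>"

definition unit_quotient :: "nat \<Rightarrow> nat \<Rightarrow> nat \<Rightarrow> (nat \<Rightarrow> int) set monoid" where
  "unit_quotient p r q = principal_unit_group p r Mod principal_units p (q + r)"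

definition roots_of_unity :: "complex monoid" where
  "roots_of_unity = \<lparr>carrier = {z. \<exists>n>0. z ^ n = 1}, monoid.mult = (\<lambda>x y. x * y), one = 1\<rparr>"

definition faithful_character :: "nat \<Rightarrow> nat \<Rightarrow> nat \<Rightarrow> ((nat \<Rightarrow> int) set \<Rightarrow> complex) \<Rightarrow> bool" where
  "faithful_character p r q \<chi> \<longleftrightarrow>
     \<chi> \<in> hom (unit_quotient p r q) roots_of_unity \<and> inj_on \<chi> (carrier (unit_quotient p r q))"

abbreviation Rq :: "nat \<Rightarrow> nat \<Rightarrow> int ring" where
  "Rq p q \<equiv> residue_ring (int p ^ q)"

text \<open>The entry $\chi(1 + p^r a b)$, with $a, b$ lifted to $\mathbf Z_p$ through their integer
  representatives; the coset does not depend on the choice of lifts.\<close>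

definition H_entry ::
  "nat \<Rightarrow> nat \<Rightarrow> nat \<Rightarrow> ((nat \<Rightarrow> int) set \<Rightarrow> complex) \<Rightarrow> int \<Rightarrow> int \<Rightarrow> complex" where
  "H_entry p r q \<chi> a b =
     \<chi> (principal_units p (q + r) #>\<^bsub>principal_unit_group p r\<^esub>
         (\<one>\<^bsub>padic_ints p\<^esub> \<oplus>\<^bsub>padic_ints p\<^esub> padic_of_int p (int p ^ r)
            \<otimes>\<^bsub>padic_ints p\<^esub> padic_of_int p a \<otimes>\<^bsub>padic_ints p\<^esub> padic_of_int p b))"

text \<open>Quadruples $(\pi, \sigma, \alpha, \omega)$.  All four functions on $R_q$ are represented by
  their extensional versions (\<open>undefined\<close> outside the carrier), so that equality of quadruples is
  equality of functions on $R_q$.\<close>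

type_synonym quadruple =
  "(int \<Rightarrow> int) \<times> (int \<Rightarrow> int) \<times> (int \<Rightarrow> complex) \<times> (int \<Rightarrow> complex)"

definition proj_mon_auts ::
  "nat \<Rightarrow> nat \<Rightarrow> nat \<Rightarrow> ((nat \<Rightarrow> int) set \<Rightarrow> complex) \<Rightarrow> quadruple set" where
  "proj_mon_auts p r q \<chi> = {(\<pi>, \<sigma>, \<alpha>, \<omega>).
     \<pi> \<in> Bij (carrier (Rq p q)) \<and> \<sigma> \<in> Bij (carrier (Rq p q)) \<and>
     \<alpha> \<in> carrier (Rq p q) \<rightarrow>\<^sub>E {z. cmod z = 1} \<and>
     \<omega> \<in> carrier (Rq p q) \<rightarrow>\<^sub>E {z. cmod z = 1} \<and>
     (\<forall>a\<in>carrier (Rq p q). \<forall>b\<in>carrier (Rq p q).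
        H_entry p r q \<chi> a (\<sigma> b) * \<omega> b = \<alpha> a * H_entry p r q \<chi> (\<pi> a) b)}"

definition scalar_rel ::
  "nat \<Rightarrow> nat \<Rightarrow> nat \<Rightarrow> ((nat \<Rightarrow> int) set \<Rightarrow> complex) \<Rightarrow> (quadruple \<times> quadruple) set" where
  "scalar_rel p r q \<chi> = {((\<pi>, \<sigma>, \<alpha>, \<omega>), (\<pi>', \<sigma>', \<alpha>', \<omega>')).
     (\<pi>, \<sigma>, \<alpha>, \<omega>) \<in> proj_mon_auts p r q \<chi> \<and> (\<pi>', \<sigma>', \<alpha>', \<omega>') \<in> proj_mon_auts p r q \<chi> \<and>
     \<pi>' = \<pi> \<and> \<sigma>' = \<sigma> \<and>
     (\<exists>\<zeta>. cmod \<zeta> = 1 \<and> (\<forall>a\<in>carrier (Rq p q). \<alpha>' a = \<zeta> * \<alpha> a) \<and>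
          (\<forall>b\<in>carrier (Rq p q). \<omega>' b = \<zeta> * \<omega> b))}"

definition mon_op :: "nat \<Rightarrow> nat \<Rightarrow> quadruple \<Rightarrow> (int \<Rightarrow> complex) \<Rightarrow> (int \<Rightarrow> complex)" where
  "mon_op p q = (\<lambda>(\<pi>, \<sigma>, \<alpha>, \<omega>) f. \<lambda>b\<in>carrier (Rq p q). \<omega> b * f (\<sigma> b))"

text \<open>The group law is composition of operators: the product of two classes consists of the
  automorphisms whose operator is a composite of operators belonging to the two classes.  The
  operator of an automorphism determines the whole quadruple, because no two distinct rows of $H$
  are proportional.\<close>

definition proj_mon_group ::
  "nat \<Rightarrow> nat \<Rightarrow> nat \<Rightarrow> ((nat \<Rightarrow> int) set \<Rightarrow> complex) \<Rightarrow> quadruple set monoid" where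
  "proj_mon_group p r q \<chi> =
     \<lparr>carrier = proj_mon_auts p r q \<chi> // scalar_rel p r q \<chi>,
      monoid.mult = (\<lambda>X Y. {z \<in> proj_mon_auts p r q \<chi>.
                \<exists>x\<in>X. \<exists>y\<in>Y. mon_op p q z = mon_op p q x \<circ> mon_op p q y}),
      one = scalar_rel p r q \<chi> ``
              {(\<lambda>a\<in>carrier (Rq p q). a, \<lambda>b\<in>carrier (Rq p q). b,
                \<lambda>a\<in>carrier (Rq p q). 1, \<lambda>b\<in>carrier (Rq p q). 1)}\<rparr>"

definition ring_frac :: "('a, 'b) ring_scheme \<Rightarrow> 'a \<Rightarrow> 'a \<Rightarrow> 'a" where
  "ring_frac R x y = x \<otimes>\<^bsub>R\<^esub> inv\<^bsub>R\<^esub> y"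

text \<open>The image of $\varepsilon = p^r$ in $R_q$.\<close>

definition eps :: "nat \<Rightarrow> nat \<Rightarrow> nat \<Rightarrow> int" where
  "eps p r q = int p ^ r mod int p ^ q"

definition triples :: "nat \<Rightarrow> nat \<Rightarrow> (int \<times> int \<times> int) set" where
  "triples p q = carrier (Rq p q) \<times> carrier (Rq p q) \<times> Units (Rq p q)"

definition triple_row_perm :: "nat \<Rightarrow> nat \<Rightarrow> nat \<Rightarrow> int \<times> int \<times> int \<Rightarrow> int \<Rightarrow> int" where
  "triple_row_perm p r q = (\<lambda>(c, s, l). let R = Rq p q; \<epsilon> = eps p r q in
     (\<lambda>a\<in>carrier R. ring_frac R (c \<oplus>\<^bsub>R\<^esub> l \<otimes>\<^bsub>R\<^esub> a) (\<one>\<^bsub>R\<^esub> \<oplus>\<^bsub>R\<^esub> \<epsilon> \<otimes>\<^bsub>R\<^esub> s \<otimes>\<^bsub>R\<^esub> a)))"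

definition triple_col_perm :: "nat \<Rightarrow> nat \<Rightarrow> nat \<Rightarrow> int \<times> int \<times> int \<Rightarrow> int \<Rightarrow> int" where
  "triple_col_perm p r q = (\<lambda>(c, s, l). let R = Rq p q; \<epsilon> = eps p r q in
     (\<lambda>b\<in>carrier R. ring_frac R (s \<oplus>\<^bsub>R\<^esub> l \<otimes>\<^bsub>R\<^esub> b) (\<one>\<^bsub>R\<^esub> \<oplus>\<^bsub>R\<^esub> \<epsilon> \<otimes>\<^bsub>R\<^esub> c \<otimes>\<^bsub>R\<^esub> b)))"

definition triple_aut ::
  "nat \<Rightarrow> nat \<Rightarrow> nat \<Rightarrow> ((nat \<Rightarrow> int) set \<Rightarrow> complex) \<Rightarrow> int \<times> int \<times> int \<Rightarrow> quadruple" where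
  "triple_aut p r q \<chi> = (\<lambda>(c, s, l).
     (triple_row_perm p r q (c, s, l),
      triple_col_perm p r q (c, s, l),
      \<lambda>a\<in>carrier (Rq p q). H_entry p r q \<chi> a s,
      \<lambda>b\<in>carrier (Rq p q). H_entry p r q \<chi> c b))"

definition triple_mult ::
  "nat \<Rightarrow> nat \<Rightarrow> nat \<Rightarrow> int \<times> int \<times> int \<Rightarrow> int \<times> int \<times> int \<Rightarrow> int \<times> int \<times> int" where
  "triple_mult p r q = (\<lambda>(c, s, l) (c', s', l').
     let R = Rq p q; \<epsilon> = eps p r q; u = \<one>\<^bsub>R\<^esub> \<oplus>\<^bsub>R\<^esub> \<epsilon> \<otimes>\<^bsub>R\<^esub> s \<otimes>\<^bsub>R\<^esub> c' in
     (ring_frac R (c \<oplus>\<^bsub>R\<^esub> l \<otimes>\<^bsub>R\<^esub> c') u,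
      ring_frac R (l' \<otimes>\<^bsub>R\<^esub> s \<oplus>\<^bsub>R\<^esub> s') u,
      ring_frac R (l \<otimes>\<^bsub>R\<^esub> l' \<oplus>\<^bsub>R\<^esub> \<epsilon> \<otimes>\<^bsub>R\<^esub> c \<otimes>\<^bsub>R\<^esub> s') u))"

end

theory Submission
  imports Defs
begin

text \<open>Put $\psi(m) = \chi(1 + p^r m)$, so that $H(a,b) = \psi(ab)$.  This function satisfies
  $\psi(x)\psi(y) = \psi(x + y + \varepsilon xy)$, has modulus $1$, and
  separates exactly the classes modulo $p^q$.
  Every identity between entries of $H$ is thereby equivalent to a congruence modulo $p^q$ in which
  one factor $\varepsilon$ has been cancelled, and the statement becomes one about Moebius
  transformations over $R_q$.\<close>

text \<open>The residue ring is local with maximal ideal generated by p, and \<open>E\<close> = p^r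
  lies in that ideal. One remark therefore makes units of all denominators 1 + E x, of the
  determinant l - E s c when l is a unit, and of the numerator l l' + E c s' when l and l' are. For
  this reason fractions are hardly ever manipulated: each is replaced by its cleared equation modulo
  \<open>N\<close>, and an identity between Moebius maps becomes an integer identity that writes one
  difference as a combination of known differences. The other source of trouble is the scalar. The
  formulas of a triple give the representative with \<omega>(0) = \<alpha>(0) = 1, and the composite
  of two such representatives is not normalised: it is off by psi(c' s). The group law thus holds
  for classes and not for the representatives, which is why a factor \<theta> accompanies every
  composition.\<close>

section \<open>Arithmetic of residue sequences\<close>

lemma padic_of_int_ring_ops:
  "padic_of_int p a \<otimes>\<^bsub>padic_ints p\<^esub> padic_of_int p b = padic_of_int p (a * b)"
  "padic_of_int p a \<oplus>\<^bsub>padic_ints p\<^esub> padic_of_int p b = padic_of_int p (a + b)"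
  "\<one>\<^bsub>padic_ints p\<^esub> = padic_of_int p 1"
  by (simp_all add: padic_ints_def padic_of_int_def fun_eq_iff mod_simps)

lemma padic_of_int_closed:
  assumes "p > 0" shows "padic_of_int p a \<in> carrier (padic_ints p)"
  using assms by (auto simp: padic_ints_def padic_of_int_def mod_mod_cancel)

lemma padic_add_closed:
  assumes "p > 0" "x \<in> carrier (padic_ints p)" "y \<in> carrier (padic_ints p)"
  shows "x \<oplus>\<^bsub>padic_ints p\<^esub> y \<in> carrier (padic_ints p)"
proof -
  have "(x (Suc n) + y (Suc n)) mod int p ^ Suc n mod int p ^ n = (x n + y n) mod int p ^ n" for n
  proof -
    have "(x (Suc n) + y (Suc n)) mod int p ^ Suc n mod int p ^ n
        = (x (Suc n) mod int p ^ n + y (Suc n) mod int p ^ n) mod int p ^ n"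
      by (simp add: mod_mod_cancel mod_simps)
    then show ?thesis using assms by (simp add: padic_ints_def)
  qed
  then show ?thesis using assms by (auto simp: padic_ints_def)
qed

lemma padic_mult_closed:
  assumes "p > 0" "x \<in> carrier (padic_ints p)" "y \<in> carrier (padic_ints p)"
  shows "x \<otimes>\<^bsub>padic_ints p\<^esub> y \<in> carrier (padic_ints p)"
proof -
  have "(x (Suc n) * y (Suc n)) mod int p ^ Suc n mod int p ^ n = (x n * y n) mod int p ^ n" for n
  proof -
    have "(x (Suc n) * y (Suc n)) mod int p ^ Suc n mod int p ^ n
        = (x (Suc n) mod int p ^ n * (y (Suc n) mod int p ^ n)) mod int p ^ n"
      by (simp add: mod_mod_cancel mod_simps)
    then show ?thesis using assms by (simp add: padic_ints_def)
  qed
  then show ?thesis using assms by (auto simp: padic_ints_def)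
qed

lemma padic_mult_assoc:
  "(x \<otimes>\<^bsub>padic_ints p\<^esub> y) \<otimes>\<^bsub>padic_ints p\<^esub> z = x \<otimes>\<^bsub>padic_ints p\<^esub> (y \<otimes>\<^bsub>padic_ints p\<^esub> z)"
  by (simp add: padic_ints_def fun_eq_iff mod_simps mult.assoc)

lemma padic_mult_commute: "x \<otimes>\<^bsub>padic_ints p\<^esub> y = y \<otimes>\<^bsub>padic_ints p\<^esub> x"
  by (simp add: padic_ints_def mult.commute)

lemma padic_one_mult:
  "x \<in> carrier (padic_ints p) \<Longrightarrow> \<one>\<^bsub>padic_ints p\<^esub> \<otimes>\<^bsub>padic_ints p\<^esub> x = x"
  by (auto simp: padic_ints_def fun_eq_iff mod_simps)

text \<open>The inverse of $1 - t$ with $p \mid t$ is the geometric series, which is finite modulo each $p^n$.\<close>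

lemma padic_principal_unit_inverse:
  fixes m :: int
  assumes "p > 0" "r \<ge> 1"
  obtains v where "v \<in> carrier (padic_ints p)"
    "v \<otimes>\<^bsub>padic_ints p\<^esub> padic_of_int p (1 + int p ^ r * m) = \<one>\<^bsub>padic_ints p\<^esub>"
proof
  define t where "t = - (int p ^ r * m)"
  define v where "v = (\<lambda>n. (\<Sum>i<n. t ^ i) mod int p ^ n)"
  have dvd: "int p ^ n dvd t ^ n" for n
    using assms by (intro dvd_power_same) (auto simp: t_def intro: dvd_mult2 dvd_power)
  have "v (Suc n) mod int p ^ n = v n" for n
  proof -
    have "v (Suc n) mod int p ^ n = ((\<Sum>i<n. t ^ i) + t ^ n) mod int p ^ n"
      by (simp add: v_def mod_mod_cancel)
    also have "\<dots> = v n"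
      using dvd[of n] unfolding v_def by (metis add.right_neutral dvd_imp_mod_0 mod_add_right_eq)
    finally show ?thesis .
  qed
  then show "v \<in> carrier (padic_ints p)"
    using assms by (auto simp: padic_ints_def v_def)
  have "(v n * ((1 - t) mod int p ^ n)) mod int p ^ n = 1 mod int p ^ n" for n
  proof -
    have "(v n * ((1 - t) mod int p ^ n)) mod int p ^ n = ((1 - t) * (\<Sum>i<n. t ^ i)) mod int p ^ n"
      by (simp add: v_def mod_simps mult.commute)
    also have "(1 - t) * (\<Sum>i<n. t ^ i) = 1 - t ^ n"
      by (metis one_diff_power_eq)
    also have "(1 - t ^ n) mod int p ^ n = 1 mod int p ^ n"
      using dvd[of n] by (simp add: mod_eq_dvd_iff)
    finally show ?thesis .
  qed
  then show "v \<otimes>\<^bsub>padic_ints p\<^esub> padic_of_int p (1 + int p ^ r * m) = \<one>\<^bsub>padic_ints p\<^esub>"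
    by (simp add: padic_ints_def padic_of_int_def t_def fun_eq_iff)
qed

section \<open>Principal units and their cosets\<close>

lemma principal_units_subset:
  "p > 0 \<Longrightarrow> principal_units p k \<subseteq> carrier (padic_ints p)"
  by (auto simp: principal_units_def padic_of_int_ring_ops(3)
        intro!: padic_add_closed padic_mult_closed padic_of_int_closed)

lemma padic_of_int_in_principal_units:
  "p > 0 \<Longrightarrow> padic_of_int p (1 + int p ^ k * m) \<in> principal_units p k"
  unfolding principal_units_def
  by (rule image_eqI[of _ _ "padic_of_int p m"]) (simp_all add: padic_of_int_ring_ops padic_of_int_closed)

lemma one_in_principal_units: "p > 0 \<Longrightarrow> \<one>\<^bsub>padic_ints p\<^esub> \<in> principal_units p k"
  using padic_of_int_in_principal_units[of p k 0] by (simp add: padic_of_int_ring_ops)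

lemma principal_units_mult_closed:
  assumes "p > 0" "x \<in> principal_units p k" "y \<in> principal_units p k"
  shows "x \<otimes>\<^bsub>padic_ints p\<^esub> y \<in> principal_units p k"
proof -
  let ?Z = "padic_ints p" and ?P = "padic_of_int p (int p ^ k)"
  obtain a b where a: "a \<in> carrier ?Z" "x = \<one>\<^bsub>?Z\<^esub> \<oplus>\<^bsub>?Z\<^esub> (?P \<otimes>\<^bsub>?Z\<^esub> a)"
    and b: "b \<in> carrier ?Z" "y = \<one>\<^bsub>?Z\<^esub> \<oplus>\<^bsub>?Z\<^esub> (?P \<otimes>\<^bsub>?Z\<^esub> b)"
    using assms by (auto simp: principal_units_def)
  \<comment> \<open>Expansion of (1 + P a)(1 + P b) as 1 + P (a + b + P a b), checked
    coordinatewise.\<close>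
  have "x \<otimes>\<^bsub>?Z\<^esub> y = \<one>\<^bsub>?Z\<^esub> \<oplus>\<^bsub>?Z\<^esub> (?P \<otimes>\<^bsub>?Z\<^esub> (a \<oplus>\<^bsub>?Z\<^esub> (b \<oplus>\<^bsub>?Z\<^esub> (?P \<otimes>\<^bsub>?Z\<^esub> (a \<otimes>\<^bsub>?Z\<^esub> b)))))"
    unfolding a b by (simp add: padic_ints_def padic_of_int_def fun_eq_iff mod_simps, simp add: algebra_simps)
  moreover have "a \<oplus>\<^bsub>?Z\<^esub> (b \<oplus>\<^bsub>?Z\<^esub> (?P \<otimes>\<^bsub>?Z\<^esub> (a \<otimes>\<^bsub>?Z\<^esub> b))) \<in> carrier ?Z"
    using assms(1) a(1) b(1) by (intro padic_add_closed padic_mult_closed padic_of_int_closed)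
  ultimately show ?thesis by (auto simp: principal_units_def)
qed

lemma principal_coset:
  "principal_units p k #>\<^bsub>principal_unit_group p r\<^esub> x = (\<lambda>u. u \<otimes>\<^bsub>padic_ints p\<^esub> x) ` principal_units p k"
  by (auto simp: r_coset_def principal_unit_group_def units_of_def)

text \<open>Commutativity regroups (u x)(v y) as (u v)(x y), and closure of the principal units
  absorbs u v; conversely a given w is split as 1 times w. Products in the quotient can thus be
  computed on representatives.\<close>

lemma principal_coset_mult:
  assumes "p > 0"
  shows "(principal_units p k #>\<^bsub>principal_unit_group p r\<^esub> x)
       <#>\<^bsub>principal_unit_group p r\<^esub> (principal_units p k #>\<^bsub>principal_unit_group p r\<^esub> y)
       = principal_units p k #>\<^bsub>principal_unit_group p r\<^esub> (x \<otimes>\<^bsub>padic_ints p\<^esub> y)"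
proof -
  let ?Z = "padic_ints p" and ?U = "principal_units p k"
  have eq: "(u \<otimes>\<^bsub>?Z\<^esub> x) \<otimes>\<^bsub>?Z\<^esub> (v \<otimes>\<^bsub>?Z\<^esub> y) = (u \<otimes>\<^bsub>?Z\<^esub> v) \<otimes>\<^bsub>?Z\<^esub> (x \<otimes>\<^bsub>?Z\<^esub> y)" for u v
    by (metis padic_mult_assoc padic_mult_commute)
  have "(\<exists>u\<in>?U. \<exists>v\<in>?U. z = (u \<otimes>\<^bsub>?Z\<^esub> x) \<otimes>\<^bsub>?Z\<^esub> (v \<otimes>\<^bsub>?Z\<^esub> y))
      \<longleftrightarrow> (\<exists>w\<in>?U. z = w \<otimes>\<^bsub>?Z\<^esub> (x \<otimes>\<^bsub>?Z\<^esub> y))" for z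
  proof
    assume "\<exists>w\<in>?U. z = w \<otimes>\<^bsub>?Z\<^esub> (x \<otimes>\<^bsub>?Z\<^esub> y)"
    then obtain w where w: "w \<in> ?U" "z = w \<otimes>\<^bsub>?Z\<^esub> (x \<otimes>\<^bsub>?Z\<^esub> y)" by blast
    have "\<one>\<^bsub>?Z\<^esub> \<otimes>\<^bsub>?Z\<^esub> w = w"
      using w(1) principal_units_subset[OF assms] by (auto intro: padic_one_mult)
    then have "z = (\<one>\<^bsub>?Z\<^esub> \<otimes>\<^bsub>?Z\<^esub> x) \<otimes>\<^bsub>?Z\<^esub> (w \<otimes>\<^bsub>?Z\<^esub> y)" using w(2) eq by simp
    then show "\<exists>u\<in>?U. \<exists>v\<in>?U. z = (u \<otimes>\<^bsub>?Z\<^esub> x) \<otimes>\<^bsub>?Z\<^esub> (v \<otimes>\<^bsub>?Z\<^esub> y)"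
      using w(1) one_in_principal_units[OF assms] by blast
  qed (use eq principal_units_mult_closed[OF assms] in metis)
  then show ?thesis
    unfolding principal_coset
    by (auto simp: set_mult_def principal_unit_group_def units_of_def image_iff)
qed

text \<open>With m = k + p^q j, the quotient of the two representatives is 1 + p^(q+r) j / (1 + p^r
  k). It lies in the smaller group because the denominator is invertible in the p-adic integers. One
  inclusion is enough, since congruence is symmetric.\<close>

lemma principal_coset_subset:
  assumes "p > 0" "r \<ge> 1" "[m = k] (mod int p ^ q)"
  shows "principal_units p (q + r) #>\<^bsub>principal_unit_group p r\<^esub> padic_of_int p (1 + int p ^ r * m)
       \<subseteq> principal_units p (q + r) #>\<^bsub>principal_unit_group p r\<^esub> padic_of_int p (1 + int p ^ r * k)"
proof -
  let ?Z = "padic_ints p" and ?U = "principal_units p (q + r)" and ?P = "padic_of_int p (int p ^ (q + r))"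
  let ?x = "padic_of_int p (1 + int p ^ r * m)" and ?y = "padic_of_int p (1 + int p ^ r * k)"
  obtain v where v: "v \<in> carrier ?Z" "v \<otimes>\<^bsub>?Z\<^esub> ?y = \<one>\<^bsub>?Z\<^esub>"
    using padic_principal_unit_inverse[OF assms(1,2)] by blast
  obtain j where j: "m = k + int p ^ q * j"
    using assms(3) by (metis cong_iff_lin cong_sym)
  define w where "w = \<one>\<^bsub>?Z\<^esub> \<oplus>\<^bsub>?Z\<^esub> (?P \<otimes>\<^bsub>?Z\<^esub> (padic_of_int p j \<otimes>\<^bsub>?Z\<^esub> v))"
  have "padic_of_int p j \<otimes>\<^bsub>?Z\<^esub> v \<in> carrier ?Z"
    using assms(1) v(1) by (intro padic_mult_closed padic_of_int_closed)
  then have w: "w \<in> ?U" by (auto simp: w_def principal_units_def)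
  have "w \<otimes>\<^bsub>?Z\<^esub> ?y = ?y \<oplus>\<^bsub>?Z\<^esub> (?P \<otimes>\<^bsub>?Z\<^esub> (padic_of_int p j \<otimes>\<^bsub>?Z\<^esub> (v \<otimes>\<^bsub>?Z\<^esub> ?y)))"
    unfolding w_def by (simp add: padic_ints_def padic_of_int_def fun_eq_iff mod_simps, simp add: algebra_simps)
  also have "\<dots> = ?x"
    unfolding v(2) by (simp add: padic_of_int_ring_ops j algebra_simps power_add)
  finally have x: "?x = w \<otimes>\<^bsub>?Z\<^esub> ?y" ..
  show ?thesis
    unfolding principal_coset x padic_mult_assoc[symmetric]
    using principal_units_mult_closed[OF assms(1) _ w] by auto
qed

text \<open>For the forward direction only coordinate q + r of the residue sequences matters: there
  every element of the smaller group reads 1, so p^(q+r) divides p^r (m - k), and cancelling p^r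
  leaves the modulus p^q.\<close>

lemma principal_coset_eq_iff:
  assumes "p > 0" "r \<ge> 1"
  shows "principal_units p (q + r) #>\<^bsub>principal_unit_group p r\<^esub> padic_of_int p (1 + int p ^ r * m)
       = principal_units p (q + r) #>\<^bsub>principal_unit_group p r\<^esub> padic_of_int p (1 + int p ^ r * k)
     \<longleftrightarrow> [m = k] (mod int p ^ q)" (is "?X = ?Y \<longleftrightarrow> _")
proof
  let ?Z = "padic_ints p" and ?P = "int p ^ (q + r)"
  let ?x = "padic_of_int p (1 + int p ^ r * m)" and ?y = "padic_of_int p (1 + int p ^ r * k)"
  assume eq: "?X = ?Y"
  have "?x \<in> ?X"
    unfolding principal_coset
    by (rule image_eqI[OF _ one_in_principal_units])
       (simp_all add: assms padic_one_mult padic_of_int_closed)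
  then obtain u where "u \<in> principal_units p (q + r)" and x: "?x = u \<otimes>\<^bsub>?Z\<^esub> ?y"
    using eq by (auto simp: principal_coset)
  then have "u (q + r) mod ?P = 1 mod ?P"
    by (auto simp: principal_units_def padic_ints_def padic_of_int_def)
  moreover have "(1 + int p ^ r * m) mod ?P = (u (q + r) * (1 + int p ^ r * k)) mod ?P"
    using fun_cong[OF x, of "q + r"] by (simp add: padic_ints_def padic_of_int_def mod_simps)
  ultimately have "(1 + int p ^ r * m) mod ?P = (1 + int p ^ r * k) mod ?P"
    by (metis mod_mult_left_eq mult_1)
  then have "int p ^ r * int p ^ q dvd int p ^ r * (m - k)"
    by (simp add: mod_eq_dvd_iff algebra_simps power_add)
  then show "[m = k] (mod int p ^ q)"
    using assms(1) by (simp add: cong_iff_dvd_diff)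
next
  assume "[m = k] (mod int p ^ q)"
  then show "?X = ?Y"
    using principal_coset_subset[OF assms] cong_sym by (metis subset_antisym)
qed

section \<open>The character as a function on integers\<close>

locale principal_unit_character =
  fixes p r q :: nat and \<chi> :: "(nat \<Rightarrow> int) set \<Rightarrow> complex"
  assumes prime_p: "prime p" and r_pos: "r \<ge> 1" and q_pos: "q \<ge> 1"
    and faithful: "faithful_character p r q \<chi>"
begin

abbreviation "N \<equiv> int p ^ q"
abbreviation "E \<equiv> int p ^ r"
abbreviation "C \<equiv> {0..<N}"

text \<open>Taken on all integers and not only on reduced residues, so that arguments such as
  \<open>a * b\<close> can be computed freely in the integers; reduction enters only through
  \<open>psi_eq_iff\<close>.\<close>

definition psi :: "int \<Rightarrow> complex" where
  "psi m = \<chi> (principal_units p (q + r) #>\<^bsub>principal_unit_group p r\<^esub> padic_of_int p (1 + E * m))"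

lemma p_pos: "p > 0"
  using prime_p by (simp add: prime_gt_0_nat)

lemma H_entry_eq: "H_entry p r q \<chi> a b = psi (a * b)"
  by (simp add: H_entry_def psi_def padic_of_int_ring_ops mult.assoc)

lemma coset_in_quotient:
  "principal_units p (q + r) #>\<^bsub>principal_unit_group p r\<^esub> padic_of_int p (1 + E * m)
     \<in> carrier (unit_quotient p r q)"
  using padic_of_int_in_principal_units[OF p_pos]
  by (auto simp: unit_quotient_def FactGroup_def RCOSETS_def principal_unit_group_def)

lemma psi_mult: "psi x * psi y = psi (x + y + E * x * y)"
proof -
  let ?c = "\<lambda>m. principal_units p (q + r) #>\<^bsub>principal_unit_group p r\<^esub> padic_of_int p (1 + E * m)"
  have "\<chi> (?c x \<otimes>\<^bsub>unit_quotient p r q\<^esub> ?c y) = psi x * psi y"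
    using faithful coset_in_quotient
    by (simp add: faithful_character_def hom_def roots_of_unity_def psi_def)
  moreover have "?c x \<otimes>\<^bsub>unit_quotient p r q\<^esub> ?c y = ?c (x + y + E * x * y)"
    using principal_coset_mult[OF p_pos]
    by (simp add: unit_quotient_def FactGroup_def padic_of_int_ring_ops algebra_simps)
  ultimately show ?thesis by (simp add: psi_def)
qed

lemma psi_eq_iff: "psi x = psi y \<longleftrightarrow> [x = y] (mod N)"
  using faithful unfolding psi_def faithful_character_def principal_coset_eq_iff[OF p_pos r_pos, symmetric]
  by (metis inj_on_eq_iff coset_in_quotient)

lemma cmod_psi [simp]: "cmod (psi x) = 1"
proof -
  have "psi x \<in> carrier roots_of_unity"
    using faithful coset_in_quotient by (auto simp: faithful_character_def hom_def psi_def)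
  then show ?thesis
    by (auto simp: roots_of_unity_def) (metis power_eq_1_iff less_numeral_extra(3))
qed

section \<open>Units and fractions modulo p^q as integer congruences\<close>

text \<open>Keeps \<open>coprime x N\<close> in one shape: as a simp rule it would take apart the
  power hidden in \<open>N\<close>, and facts stated for the modulus \<open>N\<close> would no
  longer match.\<close>

declare coprime_power_right_iff [simp del]

lemma N_gt_1: "N > 1"
  using prime_p q_pos by (metis int_ops(2) of_nat_less_iff one_less_power prime_gt_1_nat not_one_le_zero neq0_conv)

lemma residues_N: "residues N"
  using N_gt_1 by (simp add: residues_def)

lemma carrier_Rq: "carrier (Rq p q) = C"
  by (auto simp: residues.res_carrier_eq[OF residues_N])

lemmas Rq_ops = residues.res_add_eq[OF residues_N] residues.res_mult_eq[OF residues_N]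
  residues.res_one_eq[OF residues_N]

lemma Units_Rq: "x \<in> Units (Rq p q) \<longleftrightarrow> x \<in> C \<and> coprime x N"
\<comment> \<open>\<open>res_units_eq\<close> describes the units among the positive residues, so
  \<open>0\<close> is treated apart; it is not coprime to \<open>N\<close> because
  \<open>N > 1\<close>.\<close>
proof (cases "x = 0")
  case True
  then show ?thesis
    using N_gt_1 by (simp add: residues.res_units_eq[OF residues_N])
next
  case False
  then show ?thesis
    by (simp only: residues.res_units_eq[OF residues_N]) (simp add: order_less_le)
qed

lemma C_cong_eq: "x \<in> C \<Longrightarrow> y \<in> C \<Longrightarrow> [x = y] (mod N) \<Longrightarrow> x = y"
  by (simp add: cong_def)

text \<open>The workhorse for all Moebius identities. Each use supplies the multipliers
  \<open>f\<close> and \<open>g\<close> that eliminate the unwanted quantities; what remains is a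
  polynomial identity over the integers.\<close>

lemma cong_linear_combination:
  fixes a b x y :: int
  assumes "[a = b] (mod N)" "[a' = b'] (mod N)" "x - y = f * (a - b) + g * (a' - b')"
  shows "[x = y] (mod N)"
  using assms by (auto simp: cong_iff_dvd_diff)

lemma coprime_N_iff: "coprime x N \<longleftrightarrow> \<not> int p dvd x"
  using prime_p q_pos
  by (metis coprime_commute coprime_power_right_iff not_one_le_zero prime_imp_coprime prime_nat_int_transfer
      not_prime_unit coprime_absorb_left)

lemma p_dvd_E: "int p dvd E"
  using r_pos by (simp add: dvd_power)

lemma coprime_cong: "[x = y] (mod N) \<Longrightarrow> coprime x N \<Longrightarrow> coprime y N"
  by (metis cong_imp_coprime)

text \<open>Being a unit modulo \<open>N\<close> depends only on the residue modulo p, which a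
  multiple of \<open>E\<close> does not change. This serves denominators, determinants and the third
  entry of a product alike.\<close>

lemma coprime_add_E: "coprime (x + E * y) N \<longleftrightarrow> coprime x N"
  using p_dvd_E by (simp add: coprime_N_iff dvd_add_left_iff)

lemma coprime_denominator: "coprime (1 + E * x * y) N"
  using coprime_add_E[of 1 "x * y"] by (simp add: mult.assoc)

text \<open>Trades the ring inverse for a cleared congruence, the form in which fractions are used
  from here on.\<close>

lemma ring_frac:
  assumes "coprime d N"
  shows "ring_frac (Rq p q) x (d mod N) \<in> C" "[ring_frac (Rq p q) x (d mod N) * d = x] (mod N)"
proof -
  interpret residues N "Rq p q" by (rule residues_N)
  have "d mod N \<in> Units (Rq p q)"
    using assms p_pos by (simp add: Units_Rq coprime_mod_left_iff)
  then have inv: "inv\<^bsub>Rq p q\<^esub> (d mod N) \<otimes>\<^bsub>Rq p q\<^esub> (d mod N) = 1"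
    using Units_l_inv by (simp add: res_one_eq)
  show "ring_frac (Rq p q) x (d mod N) \<in> C"
    using p_pos by (simp add: ring_frac_def res_mult_eq)
  have "[inv\<^bsub>Rq p q\<^esub> (d mod N) * d = 1] (mod N)"
    using inv N_gt_1 by (simp add: res_mult_eq cong_def mod_simps)
  then have "[x * inv\<^bsub>Rq p q\<^esub> (d mod N) * d = x] (mod N)"
    using cong_scalar_left[of _ 1 N x] by (simp add: mult.assoc)
  then show "[ring_frac (Rq p q) x (d mod N) * d = x] (mod N)"
    by (simp add: ring_frac_def res_mult_eq cong_def mod_simps)
qed

section \<open>Moebius permutations of the residues\<close>

lemma triples_iff:
  "(c, s, l) \<in> triples p q \<longleftrightarrow> c \<in> C \<and> s \<in> C \<and> l \<in> C \<and> coprime l N"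
  by (simp add: triples_def carrier_Rq Units_Rq)

lemma col_perm_eq:
  "triple_col_perm p r q (c, s, l) =
     (\<lambda>b\<in>C. ring_frac (Rq p q) ((s + l * b) mod N) ((1 + E * c * b) mod N))"
  by (simp add: triple_col_perm_def carrier_Rq Rq_ops eps_def mod_simps Let_def)

text \<open>Reflects the symmetry H(a,b) = H(b,a), which exchanges rows with columns and c with s;
  everything shown for column permutations carries over to rows.\<close>

lemma row_perm_eq_col_perm: "triple_row_perm p r q (c, s, l) = triple_col_perm p r q (s, c, l)"
  by (simp add: triple_row_perm_def triple_col_perm_def)

lemma col_perm:
  assumes "b \<in> C"
  shows "triple_col_perm p r q (c, s, l) b \<in> C"
    and "[triple_col_perm p r q (c, s, l) b * (1 + E * c * b) = s + l * b] (mod N)"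
  using assms ring_frac[OF coprime_denominator, of "(s + l * b) mod N" c b]
  by (simp_all add: col_perm_eq cong_def)

lemma row_perm:
  assumes "a \<in> C"
  shows "triple_row_perm p r q (c, s, l) a \<in> C"
    and "[triple_row_perm p r q (c, s, l) a * (1 + E * s * a) = c + l * a] (mod N)"
  using col_perm[OF assms] by (simp_all only: row_perm_eq_col_perm)

text \<open>The denominator is a unit, so the cleared equation has only one solution among the
  residues. This is how values of Moebius maps are identified below.\<close>

lemma col_perm_eqI:
  assumes "b \<in> C" "z \<in> C" "[z * (1 + E * c * b) = s + l * b] (mod N)"
  shows "triple_col_perm p r q (c, s, l) b = z"
proof (rule C_cong_eq)
  have "[triple_col_perm p r q (c, s, l) b * (1 + E * c * b) = z * (1 + E * c * b)] (mod N)"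
    using col_perm(2)[OF assms(1)] assms(3) by (simp add: cong_def)
  then show "[triple_col_perm p r q (c, s, l) b = z] (mod N)"
    using cong_mult_rcancel[OF coprime_denominator] by blast
qed (use assms col_perm in auto)

lemma col_perm_extensional: "triple_col_perm p r q t \<in> extensional C"
  by (cases t) (simp add: col_perm_eq)

text \<open>The determinant l - E s c is a unit along with l, which gives injectivity; surjectivity
  follows because the set of residues is finite.\<close>

lemma col_perm_Bij:
  assumes "coprime l N"
  shows "triple_col_perm p r q (c, s, l) \<in> Bij C"
proof -
  let ?f = "triple_col_perm p r q (c, s, l)"
  have "inj_on ?f C"
  proof (rule inj_onI)
    fix b b' assume b: "b \<in> C" and b': "b' \<in> C" and eq: "?f b = ?f b'"
    \<comment> \<open>Cross-multiplication: the multipliers are the two denominators with opposite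
      signs, so the common value of the map cancels and the determinant times b - b'
      remains.\<close>
    have "[(l + E * (- s * c)) * b = (l + E * (- s * c)) * b'] (mod N)"
      by (rule cong_linear_combination[OF col_perm(2)[OF b, of c s l] col_perm(2)[OF b', of c s l],
            where f = "- (1 + E * c * b')" and g = "1 + E * c * b"])
         (simp add: eq algebra_simps)
    then have "[b = b'] (mod N)"
      using cong_mult_lcancel coprime_add_E assms by blast
    then show "b = b'" using C_cong_eq b b' by blast
  qed
  moreover have "?f ` C = C"
    using calculation col_perm(1) by (intro endo_inj_surj) auto
  ultimately show ?thesis
    using col_perm_extensional by (auto simp: Bij_def bij_betw_def)
qed

section \<open>Scalar multiples of automorphisms\<close>

lemma zero_in_C: "0 \<in> C" and one_in_C: "1 \<in> C"
  using N_gt_1 p_pos by auto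

lemma psi_zero [simp]: "psi 0 = 1"
proof -
  have "psi 0 * psi 0 = psi 0" using psi_mult[of 0 0] by simp
  moreover have "psi 0 \<noteq> 0" using cmod_psi[of 0] by (metis norm_zero zero_neq_one)
  ultimately show ?thesis by simp
qed

text \<open>The action of scalars whose orbits, for scalars of modulus 1, are the classes.
  Restricting again to \<open>C\<close> keeps the functions extensional, so that members of an orbit
  can be compared by plain equality.\<close>

definition scale :: "complex \<Rightarrow> quadruple \<Rightarrow> quadruple" where
  "scale \<zeta> = (\<lambda>(\<pi>, \<sigma>, \<alpha>, \<omega>). (\<pi>, \<sigma>, \<lambda>a\<in>C. \<zeta> * \<alpha> a, \<lambda>b\<in>C. \<zeta> * \<omega> b))"

lemma auts_iff:
  "(\<pi>, \<sigma>, \<alpha>, \<omega>) \<in> proj_mon_auts p r q \<chi> \<longleftrightarrow>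
     \<pi> \<in> Bij C \<and> \<sigma> \<in> Bij C \<and> \<alpha> \<in> C \<rightarrow>\<^sub>E {z. cmod z = 1} \<and> \<omega> \<in> C \<rightarrow>\<^sub>E {z. cmod z = 1} \<and>
     (\<forall>a\<in>C. \<forall>b\<in>C. psi (a * \<sigma> b) * \<omega> b = \<alpha> a * psi (\<pi> a * b))"
  unfolding proj_mon_auts_def carrier_Rq H_entry_eq by simp

lemma scale_in_auts:
  assumes "x \<in> proj_mon_auts p r q \<chi>" "cmod \<zeta> = 1"
  shows "scale \<zeta> x \<in> proj_mon_auts p r q \<chi>"
proof -
  obtain \<pi> \<sigma> \<alpha> \<omega> where x: "x = (\<pi>, \<sigma>, \<alpha>, \<omega>)" by (cases x)
  show ?thesis
    using assms unfolding x scale_def prod.case auts_iff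
    by (auto simp: PiE_iff norm_mult mult.left_commute mult.assoc)
qed

lemma scale_scale: "scale \<zeta> (scale \<xi> x) = scale (\<zeta> * \<xi>) x"
  by (auto simp: scale_def mult.assoc fun_eq_iff split: prod.splits)

lemma scalar_rel_iff:
  "(x, y) \<in> scalar_rel p r q \<chi> \<longleftrightarrow>
     x \<in> proj_mon_auts p r q \<chi> \<and> (\<exists>\<zeta>. cmod \<zeta> = 1 \<and> y = scale \<zeta> x)"
proof
  assume xy: "(x, y) \<in> scalar_rel p r q \<chi>"
  obtain \<pi> \<sigma> \<alpha> \<omega> where x: "x = (\<pi>, \<sigma>, \<alpha>, \<omega>)" by (cases x)
  obtain \<alpha>' \<omega>' \<zeta> where y: "y = (\<pi>, \<sigma>, \<alpha>', \<omega>')" and auts: "x \<in> proj_mon_auts p r q \<chi>" "y \<in> proj_mon_auts p r q \<chi>"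
    and \<zeta>: "cmod \<zeta> = 1" "\<forall>a\<in>C. \<alpha>' a = \<zeta> * \<alpha> a" "\<forall>b\<in>C. \<omega>' b = \<zeta> * \<omega> b"
    using xy by (auto simp: scalar_rel_def carrier_Rq x)
  have "\<alpha>' \<in> extensional C" "\<omega>' \<in> extensional C"
    using auts(2) by (auto simp: y auts_iff PiE_iff)
  then have "y = scale \<zeta> x"
    using \<zeta> by (auto simp: x y scale_def intro!: extensionalityI[of _ C])
  then show "x \<in> proj_mon_auts p r q \<chi> \<and> (\<exists>\<zeta>. cmod \<zeta> = 1 \<and> y = scale \<zeta> x)"
    using auts \<zeta> by blast
next
  assume "x \<in> proj_mon_auts p r q \<chi> \<and> (\<exists>\<zeta>. cmod \<zeta> = 1 \<and> y = scale \<zeta> x)"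
  then obtain \<zeta> where x: "x \<in> proj_mon_auts p r q \<chi>" and \<zeta>: "cmod \<zeta> = 1" "y = scale \<zeta> x" by blast
  have "scale \<zeta> x \<in> proj_mon_auts p r q \<chi>" by (rule scale_in_auts[OF x \<zeta>(1)])
  then show "(x, y) \<in> scalar_rel p r q \<chi>"
    using x \<zeta> by (cases x) (auto simp: scalar_rel_def carrier_Rq scale_def)
qed

section \<open>Triples and the classification of automorphisms\<close>

abbreviation aut :: "int \<times> int \<times> int \<Rightarrow> quadruple" where
  "aut \<equiv> triple_aut p r q \<chi>"

lemma aut_eq:
  "aut (c, s, l) = (triple_row_perm p r q (c, s, l), triple_col_perm p r q (c, s, l),
     \<lambda>a\<in>C. psi (a * s), \<lambda>b\<in>C. psi (c * b))"
  by (simp add: triple_aut_def carrier_Rq H_entry_eq)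

text \<open>By \<open>psi_mult\<close> the arguments on the two sides are a \<sigma>(b) (1 + E c b)
  + c b and a s + b \<pi>(a) (1 + E s a); clearing the fractions turns both into a s + l a b + c
  b.\<close>

lemma aut_in_auts:
  assumes "t \<in> triples p q"
  shows "aut t \<in> proj_mon_auts p r q \<chi>"
proof -
  obtain c s l where t: "t = (c, s, l)" by (cases t)
  have l: "coprime l N" using assms by (simp add: t triples_iff)
  let ?y = "triple_col_perm p r q (c, s, l)" and ?x = "triple_row_perm p r q (c, s, l)"
  have "psi (a * ?y b) * psi (c * b) = psi (a * s) * psi (?x a * b)" if "a \<in> C" "b \<in> C" for a b
    unfolding psi_mult psi_eq_iff
    by (rule cong_linear_combination[OF col_perm(2)[OF that(2), of c s l] row_perm(2)[OF that(1), of c s l],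
            where f = a and g = "- b"])
       (simp add: algebra_simps)
  then show ?thesis
    using col_perm_Bij[OF l] by (simp add: t aut_eq auts_iff row_perm_eq_col_perm)
qed

text \<open>Evaluating the defining identity at $a = 0$ and at $b = 0$ pins down $\omega$ and $\alpha$.
  Injectivity of the character then turns it into
  $a\,(\sigma(b)(1 + \varepsilon cb) - s) = b\,(\pi(a)(1 + \varepsilon sa) - c)$, which forces both
  brackets to be linear with the same slope $\lambda$.\<close>

lemma auts_classification:
  assumes "x \<in> proj_mon_auts p r q \<chi>"
  obtains t \<zeta> where "t \<in> triples p q" "cmod \<zeta> = 1" "x = scale \<zeta> (aut t)"
proof -
  obtain \<pi> \<sigma> \<alpha> \<omega> where x: "x = (\<pi>, \<sigma>, \<alpha>, \<omega>)" by (cases x)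
  have Bij: "\<pi> \<in> Bij C" "\<sigma> \<in> Bij C" and \<alpha>: "\<alpha> \<in> C \<rightarrow>\<^sub>E {z. cmod z = 1}"
    and \<omega>: "\<omega> \<in> C \<rightarrow>\<^sub>E {z. cmod z = 1}"
    using assms by (auto simp: x auts_iff)
  have eq: "psi (a * \<sigma> b) * \<omega> b = \<alpha> a * psi (\<pi> a * b)" if "a \<in> C" "b \<in> C" for a b
    using assms that by (auto simp: x auts_iff)
  have closed: "\<pi> a \<in> C" "\<sigma> a \<in> C" if "a \<in> C" for a
    using Bij that unfolding Bij_def bij_betw_def by blast+
  define c s \<zeta> where "c = \<pi> 0" "s = \<sigma> 0" "\<zeta> = \<alpha> 0"
  have \<omega>_eq: "\<omega> b = \<zeta> * psi (c * b)" if "b \<in> C" for b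
    using eq[OF zero_in_C that] by (simp add: c_s_\<zeta>_def)
  have "\<omega> 0 = \<zeta>" using \<omega>_eq[OF zero_in_C] by simp
  then have \<alpha>_eq: "\<alpha> a = \<zeta> * psi (a * s)" if "a \<in> C" for a
    using eq[OF that zero_in_C] by (simp add: c_s_\<zeta>_def mult.commute)
  have \<zeta>: "cmod \<zeta> = 1" using \<alpha> zero_in_C unfolding c_s_\<zeta>_def by blast
  define f g where "f b = \<sigma> b * (1 + E * c * b) - s" and "g a = \<pi> a * (1 + E * s * a) - c" for a b
  have fg: "[a * f b = b * g a] (mod N)" if "a \<in> C" "b \<in> C" for a b
  proof -
    have "\<zeta> * (psi (a * \<sigma> b) * psi (c * b)) = \<zeta> * (psi (a * s) * psi (\<pi> a * b))"
      using eq[OF that] by (simp only: \<omega>_eq \<alpha>_eq that mult_ac)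
    then have "psi (a * \<sigma> b) * psi (c * b) = psi (a * s) * psi (\<pi> a * b)"
      using \<zeta> by (metis mult_cancel_left norm_zero zero_neq_one)
    then have "[a * \<sigma> b + c * b + E * (a * \<sigma> b) * (c * b)
        = a * s + \<pi> a * b + E * (a * s) * (\<pi> a * b)] (mod N)"
      by (simp add: psi_mult psi_eq_iff)
    then show ?thesis
      by (simp add: cong_iff_dvd_diff f_def g_def algebra_simps)
  qed
  \<comment> \<open>The common slope: b = 1 in \<open>fg\<close> gives g(a) = a f(1), a = 1 gives
    f(b) = b g(1), and a = b = 1 identifies f(1) with g(1).\<close>
  define l where "l = f 1 mod N"
  have f1: "[f 1 = g 1] (mod N)" using fg[OF one_in_C one_in_C] by simp
  have f_eq: "[\<sigma> b * (1 + E * c * b) = s + l * b] (mod N)" if "b \<in> C" for b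
  proof -
    have "[f b = l * b] (mod N)"
      using fg[OF one_in_C that] f1 cong_scalar_left[OF f1, of b]
      unfolding l_def by (simp add: cong_def mod_simps mult.commute)
    then show ?thesis by (simp add: f_def cong_iff_dvd_diff algebra_simps)
  qed
  have g_eq: "[\<pi> a * (1 + E * s * a) = c + l * a] (mod N)" if "a \<in> C" for a
  proof -
    have "[g a = l * a] (mod N)"
      using fg[OF that one_in_C] unfolding l_def by (simp add: cong_def mod_simps mult.commute)
    then show ?thesis by (simp add: g_def cong_iff_dvd_diff algebra_simps)
  qed
  have \<sigma>_eq: "triple_col_perm p r q (c, s, l) b = \<sigma> b" if "b \<in> C" for b
    by (rule col_perm_eqI[OF that closed(2)[OF that] f_eq[OF that]])
  have \<pi>_eq: "triple_row_perm p r q (c, s, l) a = \<pi> a" if "a \<in> C" for a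
    unfolding row_perm_eq_col_perm by (rule col_perm_eqI[OF that closed(1)[OF that] g_eq[OF that]])
  have "coprime l N"
  proof (rule ccontr)
    assume "\<not> coprime l N"
    then obtain m where m: "l = int p * m" by (auto simp: coprime_N_iff)
    obtain e where e: "E = int p * e" using p_dvd_E by blast
    \<comment> \<open>A nonzero residue killed by p. If p divided l, then both l b and E b would
      vanish modulo \<open>N\<close>, so \<sigma> would take the same value at b as at 0, against
      injectivity.\<close>
    define b where "b = int p ^ (q - 1)"
    have N: "N = int p * b" using q_pos by (simp add: b_def flip: power_Suc)
    have "b > 0" using p_pos by (simp add: b_def)
    moreover have "int p > 1" using prime_p prime_gt_1_nat by auto
    ultimately have b: "b \<in> C" "b \<noteq> 0" by (auto simp: N)
    have "s * (1 + E * c * b) - (s + l * b) = N * (s * e * c - m)"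
      unfolding N m e by (simp add: algebra_simps)
    then have "[s * (1 + E * c * b) = s + l * b] (mod N)"
      by (simp add: cong_iff_dvd_diff)
    then have "\<sigma> b = \<sigma> 0"
      using col_perm_eqI[OF b(1), of s c s l] \<sigma>_eq[OF b(1)] closed(2)[OF zero_in_C]
      by (simp add: c_s_\<zeta>_def)
    then show False
      using Bij(2) b zero_in_C unfolding Bij_def bij_betw_def by (auto dest: inj_onD)
  qed
  moreover have "l \<in> C" using p_pos by (simp add: l_def)
  ultimately have t: "(c, s, l) \<in> triples p q"
    using closed zero_in_C by (simp add: triples_iff c_s_\<zeta>_def)
  have "\<sigma> = triple_col_perm p r q (c, s, l)" "\<pi> = triple_row_perm p r q (c, s, l)"
    using Bij \<sigma>_eq \<pi>_eq col_perm_extensional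
    by (auto simp: Bij_def row_perm_eq_col_perm intro!: extensionalityI[of _ C])
  moreover have "\<alpha> = (\<lambda>a\<in>C. \<zeta> * psi (a * s))" "\<omega> = (\<lambda>b\<in>C. \<zeta> * psi (c * b))"
    using \<alpha> \<omega> \<alpha>_eq \<omega>_eq by (auto simp: PiE_iff intro!: extensionalityI[of _ C])
  ultimately have "x = scale \<zeta> (aut (c, s, l))"
    by (auto simp: x aut_eq scale_def fun_eq_iff)
  then show ?thesis using that t \<zeta> by blast
qed

section \<open>Operators and their composition\<close>

lemma mon_op_eq: "mon_op p q (\<pi>, \<sigma>, \<alpha>, \<omega>) f = (\<lambda>b\<in>C. \<omega> b * f (\<sigma> b))"
  by (simp add: mon_op_def carrier_Rq)

text \<open>Products of classes are defined through operators only, so an automorphism has to be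
  recovered from its operator. Suitable test functions reveal \<omega> and \<sigma>; the defining
  identity then yields \<alpha> and \<pi>.\<close>

lemma mon_op_inj:
  assumes "x \<in> proj_mon_auts p r q \<chi>" "y \<in> proj_mon_auts p r q \<chi>" "mon_op p q x = mon_op p q y"
  shows "x = y"
proof -
  obtain \<pi> \<sigma> \<alpha> \<omega> where x: "x = (\<pi>, \<sigma>, \<alpha>, \<omega>)" by (cases x)
  obtain \<pi>' \<sigma>' \<alpha>' \<omega>' where y: "y = (\<pi>', \<sigma>', \<alpha>', \<omega>')" by (cases y)
  note X = assms(1)[unfolded x auts_iff] and Y = assms(2)[unfolded y auts_iff]
  have op: "\<omega> b * f (\<sigma> b) = \<omega>' b * f (\<sigma>' b)" if "b \<in> C" for b f
    using fun_cong[OF fun_cong[OF assms(3), of f], of b] that by (simp add: x y mon_op_eq)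
  have \<omega>: "\<omega> b = \<omega>' b" if "b \<in> C" for b
    using op[OF that, of "\<lambda>_. 1"] by simp
  have \<sigma>: "\<sigma> b = \<sigma>' b" if "b \<in> C" for b
  proof -
    have "cmod (\<omega> b) = 1" using X that by (auto simp: PiE_iff)
    then have "\<omega> b \<noteq> 0" by (metis norm_zero zero_neq_one)
    \<comment> \<open>\<open>of_int\<close> serves as an injective test function, which separates
      the points \<sigma>(b) and \<sigma>'(b).\<close>
    then show ?thesis using op[OF that, of of_int] \<omega>[OF that] by simp
  qed
  have rows: "\<alpha> a * psi (\<pi> a * b) = \<alpha>' a * psi (\<pi>' a * b)" if "a \<in> C" "b \<in> C" for a b
    using X Y \<omega> \<sigma> that by metis
  \<comment> \<open>Column 0 of H is constantly 1 and isolates \<alpha>; column 1 has pairwise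
    distinct entries and then isolates \<pi>.\<close>
  have \<alpha>: "\<alpha> a = \<alpha>' a" if "a \<in> C" for a
    using rows[OF that zero_in_C] by simp
  have \<pi>: "\<pi> a = \<pi>' a" if "a \<in> C" for a
  proof -
    have "cmod (\<alpha> a) = 1" using X that by (auto simp: PiE_iff)
    then have "\<alpha> a \<noteq> 0" by (metis norm_zero zero_neq_one)
    then have "[\<pi> a = \<pi>' a] (mod N)"
      using rows[OF that one_in_C] \<alpha>[OF that] by (simp add: psi_eq_iff)
    moreover have "\<pi> \<in> C \<rightarrow> C" "\<pi>' \<in> C \<rightarrow> C"
      using X Y by (simp_all only: Bij_imp_funcset)
    then have "\<pi> a \<in> C" "\<pi>' a \<in> C"
      using that by blast+
    ultimately show ?thesis using C_cong_eq by blast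
  qed
  have ext: "\<pi> \<in> extensional C" "\<sigma> \<in> extensional C" "\<alpha> \<in> extensional C" "\<omega> \<in> extensional C"
    "\<pi>' \<in> extensional C" "\<sigma>' \<in> extensional C" "\<alpha>' \<in> extensional C" "\<omega>' \<in> extensional C"
    using X Y by (simp_all add: Bij_def PiE_iff)
  show ?thesis
    unfolding x y using ext \<pi> \<sigma> \<alpha> \<omega> extensionalityI by (metis (no_types, lifting))
qed

text \<open>The product in cleared form. Its third entry is a unit because its numerator is
  congruent to l l' modulo p.\<close>

lemma triple_mult:
  assumes "(c, s, l) \<in> triples p q" "(c', s', l') \<in> triples p q"
  obtains c'' s'' l'' where "triple_mult p r q (c, s, l) (c', s', l') = (c'', s'', l'')"
    "(c'', s'', l'') \<in> triples p q"
    "[c'' * (1 + E * s * c') = c + l * c'] (mod N)"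
    "[s'' * (1 + E * s * c') = l' * s + s'] (mod N)"
    "[l'' * (1 + E * s * c') = l * l' + E * c * s'] (mod N)"
proof -
  let ?u = "1 + E * s * c'"
  define fr where "fr x = ring_frac (Rq p q) (x mod N) (?u mod N)" for x
  have fr: "fr x \<in> C" "[fr x * ?u = x] (mod N)" for x
    using ring_frac[OF coprime_denominator, of "x mod N"] by (simp_all add: fr_def cong_def)
  have "triple_mult p r q (c, s, l) (c', s', l')
      = (fr (c + l * c'), fr (l' * s + s'), fr (l * l' + E * c * s'))"
    by (simp add: triple_mult_def fr_def Rq_ops eps_def mod_simps Let_def)
  moreover have "coprime (fr (l * l' + E * c * s')) N"
  proof -
    have "coprime (l * l' + E * (c * s')) N"
      using assms by (simp add: triples_iff coprime_add_E)
    then have "coprime (fr (l * l' + E * c * s') * ?u) N"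
      using coprime_cong[OF cong_sym[OF fr(2)]] by (simp add: mult.assoc)
    then show ?thesis by simp
  qed
  ultimately show ?thesis
    using that fr by (simp add: triples_iff)
qed

text \<open>The operators compose like the matrices with rows $(\lambda, c)$ and $(\varepsilon s, 1)$;
  dividing by the bottom right entry $1 + \varepsilon s c'$ of the product gives \<^const>\<open>triple_mult\<close>.\<close>

lemma mon_op_comp:
  assumes "t \<in> triples p q" "t' \<in> triples p q"
  obtains \<theta> where "cmod \<theta> = 1" and "\<And>\<zeta> \<xi>. mon_op p q (scale \<zeta> (aut t)) \<circ> mon_op p q (scale \<xi> (aut t'))
      = mon_op p q (scale (\<zeta> * \<xi> * \<theta>) (aut (triple_mult p r q t t')))"
proof -
  obtain c s l where t: "t = (c, s, l)" by (cases t)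
  obtain c' s' l' where t': "t' = (c', s', l')" by (cases t')
  obtain c'' s'' l'' where mult: "triple_mult p r q t t' = (c'', s'', l'')"
    and c'': "[c'' * (1 + E * s * c') = c + l * c'] (mod N)"
    and s'': "[s'' * (1 + E * s * c') = l' * s + s'] (mod N)"
    and l'': "[l'' * (1 + E * s * c') = l * l' + E * c * s'] (mod N)"
    using triple_mult assms unfolding t t' by metis
  let ?\<sigma> = "triple_col_perm p r q (c, s, l)" and ?\<sigma>' = "triple_col_perm p r q (c', s', l')"
  let ?\<sigma>'' = "triple_col_perm p r q (c'', s'', l'')"
  let ?u = "1 + E * s * c'"
  \<comment> \<open>The weight of the composite operator is \<omega>(b) \<omega>'(\<sigma>(b)). At b
    = 0 it equals psi(c' s), as \<sigma>(0) = s, whereas the normalised weight is 1 there: this is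
    the origin of \<theta>.\<close>
  have \<omega>: "psi (c * b) * psi (c' * ?\<sigma> b) = psi (c' * s) * psi (c'' * b)" if "b \<in> C" for b
    unfolding psi_mult psi_eq_iff
    by (rule cong_linear_combination[OF col_perm(2)[OF that, of c s l] c'',
          where f = c' and g = "- b"]) (simp add: algebra_simps)
  have \<sigma>: "?\<sigma>'' b = ?\<sigma>' (?\<sigma> b)" if b: "b \<in> C" for b
  proof (rule col_perm_eqI[OF b])
    define y where "y = ?\<sigma> b"
    have y: "y \<in> C" "[y * (1 + E * c * b) = s + l * b] (mod N)"
      using col_perm[OF b] by (simp_all add: y_def)
    define z where "z = ?\<sigma>' y"
    have z: "[z * (1 + E * c' * y) = s' + l' * y] (mod N)"
      using col_perm(2)[OF y(1)] by (simp add: z_def)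
    \<comment> \<open>The outer equation is multiplied by the inner denominator 1 + E c b, and y (1
      + E c b) is replaced by s + l b.\<close>
    have "[z * ((1 + E * c * b) + E * c' * (s + l * b)) = s' * (1 + E * c * b) + l' * (s + l * b)] (mod N)"
      by (rule cong_linear_combination[OF z y(2), where f = "1 + E * c * b" and g = "l' - z * E * c'"])
         (simp add: algebra_simps)
    \<comment> \<open>Sorted by powers of b, the new denominator is u + E b (c + l c'), that is u (1
      + E c'' b); the numerator is treated likewise in the next step, and u is cancelled at the
      end.\<close>
    moreover have "[z * (1 + E * c'' * b) * ?u = z * ((1 + E * c * b) + E * c' * (s + l * b))] (mod N)"
      by (rule cong_linear_combination[OF c'' c'', where f = "z * E * b" and g = 0])
         (simp add: algebra_simps)
    moreover have "[s' * (1 + E * c * b) + l' * (s + l * b) = (s'' + l'' * b) * ?u] (mod N)"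
      by (rule cong_linear_combination[OF s'' l'', where f = "-1" and g = "- b"])
         (simp add: algebra_simps)
    ultimately have "[z * (1 + E * c'' * b) * ?u = (s'' + l'' * b) * ?u] (mod N)"
      by (simp only: cong_def)
    then show "[?\<sigma>' (?\<sigma> b) * (1 + E * c'' * b) = s'' + l'' * b] (mod N)"
      using cong_mult_rcancel[OF coprime_denominator] unfolding z_def y_def by blast
    show "?\<sigma>' (?\<sigma> b) \<in> C" using col_perm(1)[OF col_perm(1)[OF b]] .
  qed
  have "mon_op p q (scale \<zeta> (aut t)) (mon_op p q (scale \<xi> (aut t')) f) b
      = mon_op p q (scale (\<zeta> * \<xi> * psi (c' * s)) (aut (triple_mult p r q t t'))) f b" for \<zeta> \<xi> f b
  proof (cases "b \<in> C")
    case True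
    have "?\<sigma> b \<in> C" using col_perm(1)[OF True] .
    then have "mon_op p q (scale \<zeta> (aut t)) (mon_op p q (scale \<xi> (aut t')) f) b
        = \<zeta> * \<xi> * (psi (c * b) * psi (c' * ?\<sigma> b)) * f (?\<sigma>' (?\<sigma> b))"
      using True by (simp only: t t' aut_eq scale_def mon_op_eq prod.case restrict_apply' mult_ac)
    also have "\<dots> = mon_op p q (scale (\<zeta> * \<xi> * psi (c' * s)) (aut (triple_mult p r q t t'))) f b"
      using True unfolding \<omega>[OF True] \<sigma>[OF True, symmetric]
      by (simp only: mult aut_eq scale_def mon_op_eq prod.case restrict_apply' mult_ac)
    finally show ?thesis .
  next
    case False
    then show ?thesis by (simp only: mult) (simp only: t aut_eq scale_def mon_op_eq prod.case restrict_apply if_False)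
  qed
  then show ?thesis
    by (intro that[of "psi (c' * s)"]) (simp_all add: fun_eq_iff)
qed

section \<open>Classes of automorphisms and their product\<close>

definition aut_class :: "int \<times> int \<times> int \<Rightarrow> quadruple set" where
  "aut_class t = scalar_rel p r q \<chi> `` {aut t}"

lemma in_aut_class_iff:
  "t \<in> triples p q \<Longrightarrow> x \<in> aut_class t \<longleftrightarrow> (\<exists>\<zeta>. cmod \<zeta> = 1 \<and> x = scale \<zeta> (aut t))"
  using aut_in_auts by (auto simp: aut_class_def scalar_rel_iff)

text \<open>Scalars leave both permutations alone, and these determine the triple: \<pi>(0) = c,
  \<sigma>(0) = s, and then \<sigma>(1) gives l. This is the uniqueness half of the
  parametrisation.\<close>

lemma scale_aut_inj:
  assumes "t \<in> triples p q" "t' \<in> triples p q" "scale \<zeta> (aut t) = scale \<xi> (aut t')"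
  shows "t = t'"
proof -
  obtain c s l where t: "t = (c, s, l)" by (cases t)
  obtain c' s' l' where t': "t' = (c', s', l')" by (cases t')
  have C: "c \<in> C" "s \<in> C" "l \<in> C" "c' \<in> C" "s' \<in> C" "l' \<in> C"
    using assms by (simp_all add: t t' triples_iff)
  have row: "triple_row_perm p r q (c, s, l) = triple_row_perm p r q (c', s', l')"
    and col: "triple_col_perm p r q (c, s, l) = triple_col_perm p r q (c', s', l')"
    using assms(3) by (simp_all add: t t' aut_eq scale_def)
  have "[c = c'] (mod N)" "[s = s'] (mod N)"
    using row_perm(2)[OF zero_in_C, of c s l] row_perm(2)[OF zero_in_C, of c' s' l']
      col_perm(2)[OF zero_in_C, of c s l] col_perm(2)[OF zero_in_C, of c' s' l']
    by (simp_all add: row col cong_def)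
  then have cs: "c = c'" "s = s'" using C C_cong_eq by blast+
  have "[l = l'] (mod N)"
    by (rule cong_linear_combination[OF col_perm(2)[OF one_in_C, of c s l]
          col_perm(2)[OF one_in_C, of c' s' l'], where f = "-1" and g = 1])
       (use col in \<open>simp add: cs\<close>)
  then show ?thesis using cs C C_cong_eq by (auto simp: t t')
qed

text \<open>Scalars of modulus 1 are invertible, so changing the representative by \<zeta> merely
  shifts the scalar. Lets the class of any classified automorphism be rewritten with its normalised
  representative.\<close>

lemma aut_class_scale:
  assumes "t \<in> triples p q" "cmod \<zeta> = 1"
  shows "scalar_rel p r q \<chi> `` {scale \<zeta> (aut t)} = aut_class t"
proof (rule Set.set_eqI)
  fix x
  have "x \<in> scalar_rel p r q \<chi> `` {scale \<zeta> (aut t)}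
      \<longleftrightarrow> (\<exists>\<eta>. cmod \<eta> = 1 \<and> x = scale (\<eta> * \<zeta>) (aut t))"
    using scale_in_auts[OF aut_in_auts[OF assms(1)] assms(2)] by (simp add: scalar_rel_iff scale_scale)
  also have "\<dots> \<longleftrightarrow> (\<exists>\<xi>. cmod \<xi> = 1 \<and> x = scale \<xi> (aut t))" (is "?l \<longleftrightarrow> ?r")
  proof
    assume ?l
    then show ?r using assms(2) by (metis norm_mult mult_1)
  next
    assume ?r
    then obtain \<xi> where "cmod \<xi> = 1" "x = scale \<xi> (aut t)" by blast
    moreover have "\<zeta> \<noteq> 0" using assms(2) by auto
    ultimately show ?l
      using assms(2) by (intro exI[of _ "\<xi> / \<zeta>"]) (simp add: norm_divide)
  qed
  finally show "x \<in> scalar_rel p r q \<chi> `` {scale \<zeta> (aut t)} \<longleftrightarrow> x \<in> aut_class t"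
    by (simp only: in_aut_class_iff[OF assms(1)])
qed

lemma carrier_group: "carrier (proj_mon_group p r q \<chi>) = aut_class ` triples p q"
proof -
  have "\<exists>t\<in>triples p q. scalar_rel p r q \<chi> `` {x} = aut_class t" if "x \<in> proj_mon_auts p r q \<chi>" for x
    using auts_classification[OF that] aut_class_scale by metis
  moreover have "aut_class t \<in> proj_mon_auts p r q \<chi> // scalar_rel p r q \<chi>" if "t \<in> triples p q" for t
    unfolding aut_class_def using aut_in_auts[OF that] by (rule quotientI)
  ultimately show ?thesis
    by (fastforce simp: proj_mon_group_def elim!: quotientE)
qed

lemma inj_on_aut_class: "inj_on aut_class (triples p q)"
proof (rule inj_onI)
  fix t t' assume t: "t \<in> triples p q" and t': "t' \<in> triples p q" and eq: "aut_class t = aut_class t'"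
  have "scale 1 (aut t) \<in> aut_class t'"
    using in_aut_class_iff[OF t] eq norm_one by blast
  then show "t = t'"
    using in_aut_class_iff[OF t'] scale_aut_inj[OF t t'] by blast
qed

lemma triple_mult_closed:
  "t \<in> triples p q \<Longrightarrow> t' \<in> triples p q \<Longrightarrow> triple_mult p r q t t' \<in> triples p q"
  by (cases t, cases t') (metis triple_mult)

lemma mult_eq:
  "X \<otimes>\<^bsub>proj_mon_group p r q \<chi>\<^esub> Y =
    {z \<in> proj_mon_auts p r q \<chi>. \<exists>x\<in>X. \<exists>y\<in>Y. mon_op p q z = mon_op p q x \<circ> mon_op p q y}"
  by (simp add: proj_mon_group_def)

text \<open>The product collects all automorphisms with a suitable operator.
  \<open>mon_op_inj\<close> shows that none lies outside the expected class; conversely every scalar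
  occurs, because it can be distributed over the two factors.\<close>

lemma aut_class_mult:
  assumes t: "t \<in> triples p q" and t': "t' \<in> triples p q"
  shows "aut_class t \<otimes>\<^bsub>proj_mon_group p r q \<chi>\<^esub> aut_class t' = aut_class (triple_mult p r q t t')"
proof (rule Set.set_eqI)
  fix z
  let ?t'' = "triple_mult p r q t t'"
  have t'': "?t'' \<in> triples p q" by (rule triple_mult_closed[OF t t'])
  obtain \<theta> where \<theta>: "cmod \<theta> = 1" and comp:
    "\<And>\<zeta> \<xi>. mon_op p q (scale \<zeta> (aut t)) \<circ> mon_op p q (scale \<xi> (aut t'))
      = mon_op p q (scale (\<zeta> * \<xi> * \<theta>) (aut ?t''))"
    using mon_op_comp[OF t t'] by blast
  show "z \<in> aut_class t \<otimes>\<^bsub>proj_mon_group p r q \<chi>\<^esub> aut_class t' \<longleftrightarrow> z \<in> aut_class ?t''"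
  proof
    assume "z \<in> aut_class t \<otimes>\<^bsub>proj_mon_group p r q \<chi>\<^esub> aut_class t'"
    then obtain \<zeta> \<xi> where z: "z \<in> proj_mon_auts p r q \<chi>" and "cmod \<zeta> = 1" "cmod \<xi> = 1"
      and op: "mon_op p q z = mon_op p q (scale (\<zeta> * \<xi> * \<theta>) (aut ?t''))"
      unfolding mult_eq by (auto simp: in_aut_class_iff[OF t] in_aut_class_iff[OF t'] comp)
    then have norm: "cmod (\<zeta> * \<xi> * \<theta>) = 1" using \<theta> by (simp add: norm_mult)
    have "z = scale (\<zeta> * \<xi> * \<theta>) (aut ?t'')"
      by (rule mon_op_inj[OF z scale_in_auts[OF aut_in_auts[OF t''] norm] op])
    then show "z \<in> aut_class ?t''"
      using norm in_aut_class_iff[OF t''] by blast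
  next
    assume "z \<in> aut_class ?t''"
    then obtain \<zeta> where \<zeta>: "cmod \<zeta> = 1" and z: "z = scale \<zeta> (aut ?t'')"
      using in_aut_class_iff[OF t''] by blast
    have "\<theta> \<noteq> 0" using \<theta> by auto
    \<comment> \<open>Dividing by \<theta> beforehand compensates the scalar that composition
      introduces.\<close>
    then have "mon_op p q z = mon_op p q (scale (\<zeta> / \<theta>) (aut t)) \<circ> mon_op p q (scale 1 (aut t'))"
      by (simp add: comp z)
    moreover have "cmod (\<zeta> / \<theta>) = 1" using \<zeta> \<theta> by (simp add: norm_divide)
    then have "scale (\<zeta> / \<theta>) (aut t) \<in> aut_class t" "scale 1 (aut t') \<in> aut_class t'"
      using in_aut_class_iff[OF t] in_aut_class_iff[OF t'] norm_one by blast+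
    moreover have "z \<in> proj_mon_auts p r q \<chi>"
      using scale_in_auts[OF aut_in_auts[OF t''] \<zeta>] z by simp
    ultimately show "z \<in> aut_class t \<otimes>\<^bsub>proj_mon_group p r q \<chi>\<^esub> aut_class t'"
      unfolding mult_eq by blast
  qed
qed

section \<open>Group axioms and order\<close>

lemma identity_triple: "(0, 0, 1) \<in> triples p q"
  using zero_in_C one_in_C by (simp add: triples_iff)

lemma one_eq: "\<one>\<^bsub>proj_mon_group p r q \<chi>\<^esub> = aut_class (0, 0, 1)"
proof -
  have "triple_col_perm p r q (0, 0, 1) b = b" if "b \<in> C" for b
    by (rule col_perm_eqI[OF that that]) simp
  then have "triple_col_perm p r q (0, 0, 1) = (\<lambda>b\<in>C. b)"
    using col_perm_extensional by (intro extensionalityI[of _ C]) auto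
  then have "aut (0, 0, 1) = (\<lambda>a\<in>C. a, \<lambda>b\<in>C. b, \<lambda>a\<in>C. 1, \<lambda>b\<in>C. 1)"
    by (simp add: aut_eq row_perm_eq_col_perm)
  then show ?thesis
    by (simp add: proj_mon_group_def carrier_Rq aut_class_def)
qed

lemma triple_mult_one_left:
  assumes "t \<in> triples p q" shows "triple_mult p r q (0, 0, 1) t = t"
proof -
  obtain c s l where t: "t = (c, s, l)" by (cases t)
  have C: "c \<in> C" "s \<in> C" "l \<in> C" using assms by (simp_all add: t triples_iff)
  obtain c'' s'' l'' where mult: "triple_mult p r q (0, 0, 1) (c, s, l) = (c'', s'', l'')"
    and t'': "(c'', s'', l'') \<in> triples p q"
    and *: "[c'' * (1 + E * 0 * c) = 0 + 1 * c] (mod N)"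
      "[s'' * (1 + E * 0 * c) = l * 0 + s] (mod N)"
      "[l'' * (1 + E * 0 * c) = 1 * l + E * 0 * s] (mod N)"
    using triple_mult[OF identity_triple assms[unfolded t]] .
  have "[c'' = c] (mod N)" "[s'' = s] (mod N)" "[l'' = l] (mod N)"
    using * by simp_all
  then have "(c'', s'', l'') = (c, s, l)"
    using C t'' C_cong_eq unfolding triples_iff by blast
  then show ?thesis using mult t by simp
qed

text \<open>The matrix with rows (l, c) and (E s, 1) has adjugate with rows (1, -c) and (-E s, l).
  Dividing by the bottom right entry l gives the triple (-c/l, -s/l, 1/l).\<close>

lemma triple_mult_inverse_left:
  assumes "t \<in> triples p q"
  obtains t' where "t' \<in> triples p q" "triple_mult p r q t' t = (0, 0, 1)"
proof -
  obtain c s l where t: "t = (c, s, l)" by (cases t)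
  have "coprime l N" using assms by (simp add: t triples_iff)
  then obtain m where "[l * m = 1] (mod N)" using cong_solve_coprime_int by blast
  define l' where "l' = m mod N"
  have ll': "[l * l' = 1] (mod N)"
    using \<open>[l * m = 1] (mod N)\<close> by (simp add: l'_def cong_def mod_simps)
  define c' s' where "c' = - (c * l') mod N" and "s' = - (s * l') mod N"
  have c': "[c' = - (c * l')] (mod N)" and s': "[s' = - (s * l')] (mod N)"
    by (simp_all add: c'_def s'_def)
  have "coprime (l * l') N" using coprime_cong[OF cong_sym[OF ll']] by simp
  then have t': "(c', s', l') \<in> triples p q"
    using p_pos by (simp add: triples_iff l'_def c'_def s'_def)
  obtain c'' s'' l'' where mult: "triple_mult p r q (c', s', l') (c, s, l) = (c'', s'', l'')"
    and t'': "(c'', s'', l'') \<in> triples p q"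
    and *: "[c'' * (1 + E * s' * c) = c' + l' * c] (mod N)"
      "[s'' * (1 + E * s' * c) = l * s' + s] (mod N)"
      "[l'' * (1 + E * s' * c) = l' * l + E * c' * s] (mod N)"
    using triple_mult[OF t' assms[unfolded t]] by metis
  have cancel: "[x = y] (mod N)" if "[x * (1 + E * s' * c) = y * (1 + E * s' * c)] (mod N)" for x y
    using that cong_mult_rcancel[OF coprime_denominator] by blast
  have "[c'' = 0] (mod N)"
    by (rule cancel, rule cong_linear_combination[OF *(1) c', where f = 1 and g = 1]) (simp add: algebra_simps)
  moreover have "[s'' = 0] (mod N)"
  proof (rule cancel)
    have "[l * s' + s = 0] (mod N)"
      by (rule cong_linear_combination[OF s' ll', where f = l and g = "- s"]) (simp add: algebra_simps)
    then show "[s'' * (1 + E * s' * c) = 0 * (1 + E * s' * c)] (mod N)"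
      using *(2) by (simp add: cong_def)
  qed
  moreover have "[l'' = 1] (mod N)"
  proof (rule cancel)
    \<comment> \<open>Both sides are -E c s l'; hence the numerator l' l + E c' s coincides with the
      denominator 1 + E s' c.\<close>
    have "[E * c' * s = E * s' * c] (mod N)"
      by (rule cong_linear_combination[OF c' s', where f = "E * s" and g = "- (E * c)"]) (simp add: algebra_simps)
    then have "[l' * l + E * c' * s = 1 * (1 + E * s' * c)] (mod N)"
      using cong_add[OF ll'] by (simp add: mult.commute)
    then show "[l'' * (1 + E * s' * c) = 1 * (1 + E * s' * c)] (mod N)"
      using *(3) cong_trans by blast
  qed
  ultimately have "(c'', s'', l'') = (0, 0, 1)"
    using t'' C_cong_eq zero_in_C one_in_C unfolding triples_iff by blast
  then show ?thesis using that[OF t'] mult t by simp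
qed

text \<open>Inherited from composition of operators, which spares a computation with nested
  fractions. The two bracketings differ at most by a scalar, and \<open>scale_aut_inj\<close>
  discards it.\<close>

lemma triple_mult_assoc:
  assumes "t \<in> triples p q" "t' \<in> triples p q" "t'' \<in> triples p q"
  shows "triple_mult p r q (triple_mult p r q t t') t'' = triple_mult p r q t (triple_mult p r q t' t'')"
proof -
  let ?op = "\<lambda>\<zeta> t. mon_op p q (scale \<zeta> (aut t))"
  have closed: "triple_mult p r q t t' \<in> triples p q" "triple_mult p r q t' t'' \<in> triples p q"
    "triple_mult p r q (triple_mult p r q t t') t'' \<in> triples p q"
    "triple_mult p r q t (triple_mult p r q t' t'') \<in> triples p q"
    by (intro triple_mult_closed assms)+
  obtain \<theta>1 where 1: "cmod \<theta>1 = 1" "\<And>\<zeta> \<xi>. ?op \<zeta> t \<circ> ?op \<xi> t' = ?op (\<zeta> * \<xi> * \<theta>1) (triple_mult p r q t t')"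
    using mon_op_comp[OF assms(1,2)] by blast
  obtain \<theta>2 where 2: "cmod \<theta>2 = 1" "\<And>\<zeta> \<xi>. ?op \<zeta> (triple_mult p r q t t') \<circ> ?op \<xi> t''
      = ?op (\<zeta> * \<xi> * \<theta>2) (triple_mult p r q (triple_mult p r q t t') t'')"
    using mon_op_comp[OF closed(1) assms(3)] by blast
  obtain \<theta>3 where 3: "cmod \<theta>3 = 1" "\<And>\<zeta> \<xi>. ?op \<zeta> t' \<circ> ?op \<xi> t'' = ?op (\<zeta> * \<xi> * \<theta>3) (triple_mult p r q t' t'')"
    using mon_op_comp[OF assms(2,3)] by blast
  obtain \<theta>4 where 4: "cmod \<theta>4 = 1" "\<And>\<zeta> \<xi>. ?op \<zeta> t \<circ> ?op \<xi> (triple_mult p r q t' t'')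
      = ?op (\<zeta> * \<xi> * \<theta>4) (triple_mult p r q t (triple_mult p r q t' t''))"
    using mon_op_comp[OF assms(1) closed(2)] by blast
  have "?op (\<theta>1 * \<theta>2) (triple_mult p r q (triple_mult p r q t t') t'')
      = ?op (\<theta>3 * \<theta>4) (triple_mult p r q t (triple_mult p r q t' t''))"
    using comp_assoc[of "?op 1 t" "?op 1 t'" "?op 1 t''"] by (simp add: 1(2) 2(2) 3(2) 4(2))
  then have "scale (\<theta>1 * \<theta>2) (aut (triple_mult p r q (triple_mult p r q t t') t''))
      = scale (\<theta>3 * \<theta>4) (aut (triple_mult p r q t (triple_mult p r q t' t'')))"
    by (intro mon_op_inj scale_in_auts aut_in_auts closed) (simp_all add: norm_mult 1(1) 2(1) 3(1) 4(1))
  then show ?thesis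
    by (rule scale_aut_inj[OF closed(3,4)])
qed

text \<open>All axioms are transported from triples along \<open>aut_class\<close>;
  \<open>groupI\<close> asks for a left unit and left inverses.\<close>

lemma group_proj_mon: "group (proj_mon_group p r q \<chi>)"
proof (rule groupI)
  fix X assume "X \<in> carrier (proj_mon_group p r q \<chi>)"
  then obtain t where t: "t \<in> triples p q" "X = aut_class t" by (auto simp: carrier_group)
  show "\<one>\<^bsub>proj_mon_group p r q \<chi>\<^esub> \<otimes>\<^bsub>proj_mon_group p r q \<chi>\<^esub> X = X"
    using t by (simp add: one_eq aut_class_mult identity_triple triple_mult_one_left)
  obtain t' where "t' \<in> triples p q" "triple_mult p r q t' t = (0, 0, 1)"
    using triple_mult_inverse_left[OF t(1)] .
  then show "\<exists>Y\<in>carrier (proj_mon_group p r q \<chi>).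
      Y \<otimes>\<^bsub>proj_mon_group p r q \<chi>\<^esub> X = \<one>\<^bsub>proj_mon_group p r q \<chi>\<^esub>"
    using t by (auto simp: carrier_group one_eq aut_class_mult intro!: bexI[of _ t'])
qed (auto simp: carrier_group one_eq aut_class_mult triple_mult_closed identity_triple triple_mult_assoc)

lemma card_triples: "card (triples p q) = p ^ (2 * q) * totient (p ^ q)"
proof -
  have "card (Units (Rq p q)) = totient (nat N)"
    using residues.totient_eq[OF residues_N] by simp
  moreover have "nat N = p ^ q" by (simp add: nat_power_eq)
  ultimately show ?thesis
    by (simp add: triples_def carrier_Rq card_cartesian_product power_add mult_2)
qed

end

theorem theorem3p2:
  fixes p r q :: nat and \<chi> :: "(nat \<Rightarrow> int) set \<Rightarrow> complex"
  assumes "prime p" and "odd p" and "r \<ge> 1" and "q \<ge> 1"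
    and "faithful_character p r q \<chi>"
  shows "(\<forall>x\<in>proj_mon_auts p r q \<chi>.
            \<exists>!t. t \<in> triples p q \<and> (triple_aut p r q \<chi> t, x) \<in> scalar_rel p r q \<chi>)
       \<and> (\<forall>t\<in>triples p q. triple_aut p r q \<chi> t \<in> proj_mon_auts p r q \<chi>)
       \<and> group (proj_mon_group p r q \<chi>)
       \<and> bij_betw (\<lambda>t. scalar_rel p r q \<chi> `` {triple_aut p r q \<chi> t})
            (triples p q) (carrier (proj_mon_group p r q \<chi>))
       \<and> card (carrier (proj_mon_group p r q \<chi>)) = p ^ (2 * q) * totient (p ^ q)
       \<and> (\<forall>t\<in>triples p q. \<forall>t'\<in>triples p q.
            triple_mult p r q t t' \<in> triples p q \<and>
            scalar_rel p r q \<chi> `` {triple_aut p r q \<chi> t}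
              \<otimes>\<^bsub>proj_mon_group p r q \<chi>\<^esub> scalar_rel p r q \<chi> `` {triple_aut p r q \<chi> t'}
            = scalar_rel p r q \<chi> `` {triple_aut p r q \<chi> (triple_mult p r q t t')})"
proof -
  interpret principal_unit_character p r q \<chi>
    using assms by unfold_locales auto
  have "\<exists>!t. t \<in> triples p q \<and> (aut t, x) \<in> scalar_rel p r q \<chi>" if x: "x \<in> proj_mon_auts p r q \<chi>" for x
  proof -
    obtain t \<zeta> where t: "t \<in> triples p q" "cmod \<zeta> = 1" "x = scale \<zeta> (aut t)"
      using auts_classification[OF x] .
    show ?thesis
    proof (rule ex1I[of _ t])
      show "t \<in> triples p q \<and> (aut t, x) \<in> scalar_rel p r q \<chi>"
        using t aut_in_auts scalar_rel_iff by blast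
      show "t' = t" if "t' \<in> triples p q \<and> (aut t', x) \<in> scalar_rel p r q \<chi>" for t'
        using that t scale_aut_inj scalar_rel_iff by metis
    qed
  qed
  moreover have bij: "bij_betw aut_class (triples p q) (carrier (proj_mon_group p r q \<chi>))"
    using inj_on_aut_class by (simp add: bij_betw_def carrier_group)
  ultimately show ?thesis
    using aut_in_auts group_proj_mon bij_betw_same_card[OF bij] card_triples triple_mult_closed aut_class_mult
    by (simp add: aut_class_def[abs_def])
qed

end
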